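(* Let $d\ge 2$ and let $N=2^n$. Let $\mathcal A:\mathbb C^{N^d}\to\mathbb C^m$ be a linear map such that, composed with the orthonormal discrete $d$-dimensional Haar wavelet transform $\mathcal H:\mathbb C^{N^d}\to\mathbb C^{N^d}$, the resulting operator $\mathcal A\mathcal H^{*}:\mathbb C^{N^d}\to\mathbb C^m$ satisfies the restricted isometry property of order $2s$ and level $\delta<1$. Then there is a universal constant $C>0$ such that the following holds: if $\boldsymbol v\in\mathbb C^{N^d}$ satisfies the tube constraint $\|\mathcal A(\boldsymbol v)\|_2\le\varepsilon$, then $$\|\boldsymbol v\|_2\le C\,\frac{\|\boldsymbol v\|_{TV_1}}{\sqrt s}\log(N^d)+\varepsilon,$$ and so, by equivalence of the isotropic and anisotropic total variation seminorms up to a factor of $\sqrt d$, $$\|\boldsymbol v\|_2\le C\,\frac{\|\boldsymbol v\|_{TV_2}}{\sqrt{s/d}}\log(N^d)+\varepsilon.$$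
   Context: **Arrays.** $\mathbb C^{N^d}$ is the space of arrays $\boldsymbol x=(x_\alpha)$, $\alpha\in[N]^d=\{1,\dots,N\}^d$, with entrywise $\ell_2$ norm $\|\cdot\|_2$; $s$ and $m$ are positive integers. **Gradient and total variation.** The gradient $\nabla\boldsymbol x\in\mathbb C^{N^d\times d}$ is $(\nabla\boldsymbol x)_{\alpha,\ell}=x_{(\alpha_1,\dots,\alpha_\ell+1,\dots,\alpha_d)}-x_\alpha$ if $\alpha_\ell\le N-1$ and $0$ if $\alpha_\ell=N$. The anisotropic and isotropic total variation seminorms are $\|\boldsymbol x\|_{TV_1}=\sum_{\alpha}\sum_{\ell=1}^d|(\nabla\boldsymbol x)_{\alpha,\ell}|$ and $\|\boldsymbol x\|_{TV_2}=\sum_{\alpha}\big(\sum_{\ell=1}^d|(\nabla\boldsymbol x)_{\alpha,\ell}|^2\big)^{1/2}$. **Restricted isometry property (RIP).** A linear operator $\mathcal L:\mathbb C^{N^d}\to\mathbb C^m$ has the RIP of order $k$ and level $\delta\in(0,1)$ if $(1-\delta)\|\boldsymbol z\|_2^2\le\|\mathcal L(\boldsymbol z)\|_2^2\le(1+\delta)\|\boldsymbol z\|_2^2$ for every $\boldsymbol z$ with at most $k$ nonzero entries. **Discrete Haar transform.** Let $h^0=1_{[0,1)}$ and $h^1=1_{[0,1/2)}-1_{[1/2,1)}$. For $\boldsymbol e\in V=\{0,1\}^d\setminus\{0\}$ let $h^{\boldsymbol e}(u)=\prod_{i=1}^d h^{e_i}(u_i)$, and $h^{\boldsymbol e}_{j,k}(u)=2^{jd/2}h^{\boldsymbol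 e}(2^ju-k)$ for $0\le j\le n-1$, $k\in\{0,\dots,2^j-1\}^d$. Set $\boldsymbol h_0(\alpha)=N^{-d/2}$ and $\boldsymbol h_{j,k,\boldsymbol e}(\alpha)=N^{-d/2}h^{\boldsymbol e}_{j,k}((\alpha-\mathbf 1)/N)$, where $\mathbf 1=(1,\dots,1)$. These $N^d$ arrays form an orthonormal basis of $\mathbb C^{N^d}$, and $\mathcal H(\boldsymbol x)$ is the array of coefficients of $\boldsymbol x$ in this basis; $\mathcal H$ is unitary and $\mathcal H^*=\mathcal H^{-1}$.
   Formalization: Both right-hand sides are divided by √(1−δ), since with coefficient 1 on ε the bound fails (A = √(1−δ)·H, v constant); C may depend on d (an absolute C is impossible) but not on n, s, m, δ, A, v, ε. *)

theory Defs
  imports "HOL-Analysis.Analysis"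
begin

(* Arrays indexed by a finite set I are the functions vanishing off I; they form a
   complex vector space of dimension card I.  Since m, n and the index sets vary below
   the existential quantifier over the constant, dimensions are carried by sets, not types. *)
definition arrays :: "'i set \<Rightarrow> ('i \<Rightarrow> complex) set" where
  "arrays I = {x. \<forall>i. i \<notin> I \<longrightarrow> x i = 0}"

definition l2norm :: "'i set \<Rightarrow> ('i \<Rightarrow> complex) \<Rightarrow> real" where
  "l2norm I x = L2_set (\<lambda>i. cmod (x i)) I"

definition linear_operator ::
  "'i set \<Rightarrow> 'j set \<Rightarrow> (('i \<Rightarrow> complex) \<Rightarrow> ('j \<Rightarrow> complex)) \<Rightarrow> bool" where
  "linear_operator I J L \<longleftrightarrow>
     (\<forall>x\<in>arrays I. L x \<in> arrays J) \<and>
     (\<forall>x\<in>arrays I. \<forall>y\<in>arrays I. L (\<lambda>i. x i + y i) = (\<lambda>j. L x j + L y j)) \<and>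
     (\<forall>c. \<forall>x\<in>arrays I. L (\<lambda>i. c * x i) = (\<lambda>j. c * L x j))"

definition RIP ::
  "'i set \<Rightarrow> 'j set \<Rightarrow> (('i \<Rightarrow> complex) \<Rightarrow> ('j \<Rightarrow> complex)) \<Rightarrow> nat \<Rightarrow> real \<Rightarrow> bool" where
  "RIP I J L k \<delta> \<longleftrightarrow> 0 < \<delta> \<and> \<delta> < 1 \<and>
     (\<forall>z\<in>arrays I. card {i\<in>I. z i \<noteq> 0} \<le> k \<longrightarrow>
        (1 - \<delta>) * (l2norm I z)\<^sup>2 \<le> (l2norm J (L z))\<^sup>2 \<and>
        (l2norm J (L z))\<^sup>2 \<le> (1 + \<delta>) * (l2norm I z)\<^sup>2)"

(* Coordinates are numbered 0, ..., d - 1; their values run through 1, ..., N. *)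
definition grid :: "nat \<Rightarrow> nat \<Rightarrow> (nat \<Rightarrow> nat) set" where
  "grid d N = {..<d} \<rightarrow>\<^sub>E {1..N}"

definition grad :: "nat \<Rightarrow> ((nat \<Rightarrow> nat) \<Rightarrow> complex) \<Rightarrow> (nat \<Rightarrow> nat) \<Rightarrow> nat \<Rightarrow> complex" where
  "grad N x \<alpha> l = (if \<alpha> l < N then x (\<alpha>(l := \<alpha> l + 1)) - x \<alpha> else 0)"

definition TV1 :: "nat \<Rightarrow> nat \<Rightarrow> ((nat \<Rightarrow> nat) \<Rightarrow> complex) \<Rightarrow> real" where
  "TV1 d N x = (\<Sum>\<alpha>\<in>grid d N. \<Sum>l<d. cmod (grad N x \<alpha> l))"

definition TV2 :: "nat \<Rightarrow> nat \<Rightarrow> ((nat \<Rightarrow> nat) \<Rightarrow> complex) \<Rightarrow> real" where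
  "TV2 d N x = (\<Sum>\<alpha>\<in>grid d N. sqrt (\<Sum>l<d. (cmod (grad N x \<alpha> l))\<^sup>2))"

definition haar1 :: "nat \<Rightarrow> real \<Rightarrow> real" where
  "haar1 b t = (if b = 0 then indicator {0..<1} t
                else indicator {0..<1/2} t - indicator {1/2..<1} t)"

definition haar_cube :: "nat \<Rightarrow> (nat \<Rightarrow> nat) \<Rightarrow> (nat \<Rightarrow> real) \<Rightarrow> real" where
  "haar_cube d e u = (\<Prod>i<d. haar1 (e i) (u i))"

definition haar_fun ::
  "nat \<Rightarrow> nat \<Rightarrow> (nat \<Rightarrow> nat) \<Rightarrow> (nat \<Rightarrow> nat) \<Rightarrow> (nat \<Rightarrow> real) \<Rightarrow> real" where
  "haar_fun d j k e u =
     2 powr (real j * real d / 2) * haar_cube d e (\<lambda>i. 2 ^ j * u i - real (k i))"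

(* None labels the constant array, Some (j, k, e) the wavelet of scale j, shift k, type e. *)
type_synonym haar_label = "(nat \<times> (nat \<Rightarrow> nat) \<times> (nat \<Rightarrow> nat)) option"

definition haar_labels :: "nat \<Rightarrow> nat \<Rightarrow> haar_label set" where
  "haar_labels d n = insert None
     {Some (j, k, e) | j k e. j < n \<and> k \<in> {..<d} \<rightarrow>\<^sub>E {..<2 ^ j} \<and>
        e \<in> {..<d} \<rightarrow>\<^sub>E {0, 1} \<and> (\<exists>i<d. e i \<noteq> 0)}"

definition haar_array :: "nat \<Rightarrow> nat \<Rightarrow> haar_label \<Rightarrow> (nat \<Rightarrow> nat) \<Rightarrow> real" where
  "haar_array d n b \<alpha> =
     (2 ^ n) powr (- real d / 2) *
       (case b of None \<Rightarrow> 1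
        | Some (j, k, e) \<Rightarrow> haar_fun d j k e (\<lambda>i. (real (\<alpha> i) - 1) / 2 ^ n))"

definition haar_transform ::
  "nat \<Rightarrow> nat \<Rightarrow> ((nat \<Rightarrow> nat) \<Rightarrow> complex) \<Rightarrow> (haar_label \<Rightarrow> complex)" where
  "haar_transform d n x = (\<lambda>b. if b \<in> haar_labels d n
     then \<Sum>\<alpha>\<in>grid d (2 ^ n). x \<alpha> * cnj (of_real (haar_array d n b \<alpha>)) else 0)"

definition haar_adjoint ::
  "nat \<Rightarrow> nat \<Rightarrow> (haar_label \<Rightarrow> complex) \<Rightarrow> ((nat \<Rightarrow> nat) \<Rightarrow> complex)" where
  "haar_adjoint d n z = (\<lambda>\<alpha>. if \<alpha> \<in> grid d (2 ^ n)
     then \<Sum>b\<in>haar_labels d n. z b * of_real (haar_array d n b \<alpha>) else 0)"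

lemma haar_adjoint_works:
  "(\<Sum>b\<in>haar_labels d n. haar_transform d n x b * cnj (z b)) =
   (\<Sum>\<alpha>\<in>grid d (2 ^ n). x \<alpha> * cnj (haar_adjoint d n z \<alpha>))"
proof -
  have "(\<Sum>b\<in>haar_labels d n. haar_transform d n x b * cnj (z b)) =
    (\<Sum>b\<in>haar_labels d n. \<Sum>\<alpha>\<in>grid d (2 ^ n).
        x \<alpha> * of_real (haar_array d n b \<alpha>) * cnj (z b))"
    by (simp add: haar_transform_def sum_distrib_right)
  also have "\<dots> = (\<Sum>\<alpha>\<in>grid d (2 ^ n). \<Sum>b\<in>haar_labels d n.
        x \<alpha> * of_real (haar_array d n b \<alpha>) * cnj (z b))"
    by (rule sum.swap)
  also have "\<dots> = (\<Sum>\<alpha>\<in>grid d (2 ^ n). x \<alpha> * cnj (haar_adjoint d n z \<alpha>))"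
    by (simp add: haar_adjoint_def sum_distrib_left mult_ac)
  finally show ?thesis .
qed

end

theory Submission
  imports Defs
begin

text \<open>
  The logarithm leaves enough room to bound the \<open>\<ell>\<^sub>1\<close> norm of the non-constant Haar coefficients
  directly, without their weak-\<open>\<ell>\<^sub>1\<close> decay. A wavelet whose support has side \<open>2 * M\<close> has type \<open>e\<close>
  with \<open>e i \<noteq> 0\<close> for some \<open>i\<close>; pairing the two halves of its cube along coordinate \<open>i\<close> bounds its
  coefficient by \<open>(2 * M) powr (- d / 2) * M\<close> times the variation of the array inside the cube, and
  this factor is at most 1 because \<open>d \<ge> 2\<close>. The cubes of one scale are disjoint, so every one of the
  \<open>n\<close> scales contributes at most \<open>2 ^ d\<close> times the total variation. The restricted isometry property
  then controls the constant coefficient together with the \<open>s\<close> largest others, while the remaining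
  ones, cut into blocks of size \<open>s\<close>, have \<open>\<ell>\<^sub>2\<close> norms summing to at most the \<open>\<ell>\<^sub>1\<close> norm over \<open>sqrt s\<close>.
\<close>

section \<open>Robust recovery from the restricted isometry property\<close>

lemma l2norm_nonneg: "0 \<le> l2norm I x"
  by (simp add: l2norm_def)

lemma l2norm_triangle: "l2norm I (\<lambda>i. x i + y i) \<le> l2norm I x + l2norm I y"
  unfolding l2norm_def
  by (rule order_trans[OF L2_set_mono L2_set_triangle_ineq]) (auto intro: norm_triangle_ineq)

lemma l2norm_minus: "l2norm I (\<lambda>i. - x i) = l2norm I x"
  by (simp add: l2norm_def)

text \<open>Entries off \<open>T\<close> are set to zero while the index set stays the same, so
  every piece of a vector lies in \<open>arrays I\<close> and can be fed to \<open>L\<close> and to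
  the RIP.\<close>

definition restr :: "'i set \<Rightarrow> ('i \<Rightarrow> complex) \<Rightarrow> 'i \<Rightarrow> complex" where
  "restr T x = (\<lambda>i. if i \<in> T then x i else 0)"

lemma restr_arrays: "T \<subseteq> I \<Longrightarrow> restr T x \<in> arrays I"
  by (auto simp: restr_def arrays_def)

lemma restr_Un: "A \<inter> B = {} \<Longrightarrow> restr (A \<union> B) x = (\<lambda>i. restr A x i + restr B x i)"
  by (auto simp: restr_def fun_eq_iff)

lemma restr_eq: "x \<in> arrays I \<Longrightarrow> restr I x = x"
  by (auto simp: restr_def arrays_def fun_eq_iff)

lemma l2norm_restr_le:
  assumes "finite I" "T \<subseteq> I" "card T \<le> s" "\<And>i. i \<in> T \<Longrightarrow> cmod (x i) \<le> M" "0 \<le> M"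
  shows "l2norm I (restr T x) \<le> sqrt s * M"
proof -
  have "(\<Sum>i\<in>I. (cmod (restr T x i))\<^sup>2) = (\<Sum>i\<in>T. (cmod (x i))\<^sup>2)"
    using assms by (intro sum.mono_neutral_cong_right) (auto simp: restr_def)
  also have "\<dots> \<le> real (card T) * M\<^sup>2"
    using assms by (intro sum_bounded_above) (auto intro: power_mono)
  also have "\<dots> \<le> s * M\<^sup>2"
    using assms by (intro mult_right_mono) auto
  finally have "l2norm I (restr T x) \<le> sqrt (s * M\<^sup>2)"
    unfolding l2norm_def L2_set_def by (rule real_sqrt_le_mono)
  then show ?thesis
    using assms by (simp add: real_sqrt_mult)
qed

text \<open>Greedy selection: each step adds an element with maximal \<open>f\<close> among those
  left, so ties cause no difficulty.\<close>

lemma ex_top_subset: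
  fixes f :: "'a \<Rightarrow> real"
  assumes "finite R" "s \<le> card R"
  shows "\<exists>T\<subseteq>R. card T = s \<and> (\<forall>a\<in>T. \<forall>b\<in>R - T. f b \<le> f a)"
  using assms(2)
proof (induction s)
  case 0
  show ?case by (rule exI[of _ "{}"]) auto
next
  case (Suc s)
  then obtain T where T: "T \<subseteq> R" "card T = s" "\<forall>a\<in>T. \<forall>b\<in>R - T. f b \<le> f a"
    by auto
  have "finite T" using T assms finite_subset by auto
  have "R - T \<noteq> {}"
    using T Suc.prems card_mono[OF \<open>finite T\<close>, of R] by fastforce
  then have "Max (f ` (R - T)) \<in> f ` (R - T)"
    using assms(1) by (intro Max_in) auto
  then obtain a where a: "a \<in> R - T" "f a = Max (f ` (R - T))"
    by (metis imageE)
  have amax: "f b \<le> f a" if "b \<in> R - T" for b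
    using that a assms(1) by auto
  show ?case
    by (rule exI[of _ "insert a T"]) (use a amax T \<open>finite T\<close> in auto)
qed

text \<open>With more than \<open>s\<close> elements, \<open>T\<close> consists of the
  \<open>s\<close> largest values, and any other value is at most each of them, hence at most their
  average. Otherwise \<open>T = R\<close> and nothing is left to dominate. Nonemptiness of
  \<open>T\<close> makes the peeling of blocks terminate.\<close>

lemma ex_dominating_subset:
  fixes f :: "'a \<Rightarrow> real"
  assumes "finite R" "\<And>a. a \<in> R \<Longrightarrow> 0 \<le> f a" "s > 0"
  shows "\<exists>T\<subseteq>R. card T \<le> s \<and> (R \<noteq> {} \<longrightarrow> T \<noteq> {}) \<and> (\<forall>b\<in>R - T. f b \<le> sum f T / s)"
proof (cases "card R \<le> s")
  case True
  then show ?thesis by (intro exI[of _ R]) auto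
next
  case False
  then obtain T where T: "T \<subseteq> R" "card T = s" "\<forall>a\<in>T. \<forall>b\<in>R - T. f b \<le> f a"
    using ex_top_subset[OF assms(1), of s f] by auto
  have "f b \<le> sum f T / s" if "b \<in> R - T" for b
  proof -
    have "real (card T) * f b \<le> sum f T"
      using T that by (intro sum_bounded_below) auto
    then show ?thesis
      using assms(3) T by (simp add: field_simps)
  qed
  then show ?thesis using T assms(3) by (intro exI[of _ T]) auto
qed

text \<open>Peel off blocks of size \<open>s\<close> in decreasing order of magnitude: the entries of each block are at
  most the average over the preceding block.\<close>
lemma block_bound:
  fixes F :: "'i set \<Rightarrow> real" and x :: "'i \<Rightarrow> complex"
  assumes "finite R" "s > 0" "0 \<le> K" "0 \<le> M" "\<And>i. i \<in> R \<Longrightarrow> cmod (x i) \<le> M"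
    and "F {} = 0"
    and subadd: "\<And>S T. S \<subseteq> R \<Longrightarrow> T \<subseteq> R \<Longrightarrow> S \<inter> T = {} \<Longrightarrow> F (S \<union> T) \<le> F S + F T"
    and block: "\<And>T M'. T \<subseteq> R \<Longrightarrow> card T \<le> s \<Longrightarrow> 0 \<le> M' \<Longrightarrow>
      (\<And>i. i \<in> T \<Longrightarrow> cmod (x i) \<le> M') \<Longrightarrow> F T \<le> K * (sqrt s * M')"
  shows "F R \<le> K * (sqrt s * M + (\<Sum>i\<in>R. cmod (x i)) / sqrt s)"
  using assms(1,4,5,7,8)
proof (induction R arbitrary: M rule: finite_psubset_induct)
  case (psubset R)
  show ?case
  proof (cases "R = {}")
    case True
    then show ?thesis using assms(3,6) psubset.prems(1) by simp
  next
    case False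
    obtain T where T: "T \<subseteq> R" "card T \<le> s" "T \<noteq> {}"
      and dom: "\<forall>i\<in>R - T. cmod (x i) \<le> (\<Sum>i\<in>T. cmod (x i)) / s"
      using ex_dominating_subset[OF psubset.hyps, of "\<lambda>i. cmod (x i)" s] False assms(2) by auto
    define a where "a = (\<Sum>i\<in>T. cmod (x i))"
    have "a \<ge> 0" unfolding a_def by (simp add: sum_nonneg)
    \<comment> \<open>The average over \<open>T\<close> becomes the new bound on the entries. Its
      contribution \<open>sqrt s * (a / s) = a / sqrt s\<close> is exactly the share of
      \<open>T\<close> in the final sum.\<close>
    have "F (R - T) \<le> K * (sqrt s * (a / s) + (\<Sum>i\<in>R - T. cmod (x i)) / sqrt s)"
    proof (rule psubset.IH)
      show "R - T \<subset> R" using T by auto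
      show "0 \<le> a / s" using \<open>a \<ge> 0\<close> by simp
      show "cmod (x i) \<le> a / s" if "i \<in> R - T" for i using dom that a_def by auto
      show "F (S \<union> T') \<le> F S + F T'" if "S \<subseteq> R - T" "T' \<subseteq> R - T" "S \<inter> T' = {}" for S T'
        using that psubset.prems(3) by blast
      show "F T' \<le> K * (sqrt s * M')" if "T' \<subseteq> R - T" "card T' \<le> s" "0 \<le> M'"
        "\<And>i. i \<in> T' \<Longrightarrow> cmod (x i) \<le> M'" for T' M'
        using that by (intro psubset.prems(4)) auto
    qed
    moreover have "F T \<le> K * (sqrt s * M)"
      using T psubset.prems by (intro psubset.prems(4)) auto
    moreover have "F R \<le> F T + F (R - T)"
      using psubset.prems(3)[of T "R - T"] T by (simp add: Un_absorb1)
    moreover have sum_eq: "(\<Sum>i\<in>R. cmod (x i)) = a + (\<Sum>i\<in>R - T. cmod (x i))"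
      unfolding a_def using sum.subset_diff[OF T(1) psubset.hyps] by (simp add: add.commute)
    moreover have "sqrt s * (a / s) = a / sqrt s"
      using assms(2) by (simp add: field_simps)
    ultimately have "F R \<le> K * (sqrt s * M) + K * (a / sqrt s + (\<Sum>i\<in>R - T. cmod (x i)) / sqrt s)"
      by simp
    then show ?thesis
      by (simp only: sum_eq distrib_left add_divide_distrib)
  qed
qed

text \<open>Split \<open>z\<close> into a head, on which the lower RIP bound applies, and a tail cut
  into blocks, on which the upper bound applies. The index \<open>b\<close> stays out of the sum
  because it will be the constant Haar coefficient, on which the total variation has no hold. In
  \<open>1 + sqrt 2\<close>, the 1 is the norm of the tail itself and \<open>sqrt 2\<close> that of
  its image.\<close>

lemma RIP_l2norm_bound:
  assumes I: "finite I" and s: "s > 0" and L: "linear_operator I J L"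
    and rip: "RIP I J L (2 * s) \<delta>" and z: "z \<in> arrays I" and b: "b \<in> I"
  shows "sqrt (1 - \<delta>) * l2norm I z \<le>
    l2norm J (L z) + (1 + sqrt 2) * (\<Sum>i\<in>I - {b}. cmod (z i)) / sqrt s"
proof -
  define R where "R = I - {b}"
  have finR: "finite R" using I R_def by auto
  have \<delta>: "0 < \<delta>" "\<delta> < 1" using rip by (auto simp: RIP_def)
  obtain T where T: "T \<subseteq> R" "card T \<le> s"
    and dom: "\<forall>i\<in>R - T. cmod (z i) \<le> (\<Sum>i\<in>T. cmod (z i)) / s"
    using ex_dominating_subset[OF finR, of "\<lambda>i. cmod (z i)" s] s by auto
  \<comment> \<open>\<open>b\<close> joins the head whatever its size; the head then has at most
    \<open>s + 1 \<le> 2 * s\<close> indices.\<close>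
  define T0 where "T0 = insert b T"
  define a where "a = (\<Sum>i\<in>T. cmod (z i))"
  have "a \<ge> 0" unfolding a_def by (simp add: sum_nonneg)
  have finT: "finite T" using T finR finite_subset by auto
  have card: "card {i \<in> I. restr S z i \<noteq> 0} \<le> card S" if "S \<subseteq> I" for S
    using that I finite_subset by (intro card_mono) (auto simp: restr_def)
  \<comment> \<open>Replacing \<open>1 + \<delta>\<close> by 2 keeps the constant free of
    \<open>\<delta>\<close>.\<close>
  have upper: "l2norm J (L (restr S z)) \<le> sqrt 2 * l2norm I (restr S z)"
    if "S \<subseteq> I" "card S \<le> 2 * s" for S
  proof -
    have "(l2norm J (L (restr S z)))\<^sup>2 \<le> (1 + \<delta>) * (l2norm I (restr S z))\<^sup>2"
      using rip restr_arrays[OF that(1)] card[OF that(1)] that(2) unfolding RIP_def by force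
    also have "\<dots> \<le> 2 * (l2norm I (restr S z))\<^sup>2"
      using \<delta> by (intro mult_right_mono) auto
    finally have "(l2norm J (L (restr S z)))\<^sup>2 \<le> (sqrt 2 * l2norm I (restr S z))\<^sup>2"
      by (simp add: power_mult_distrib)
    then show ?thesis
      by (rule power2_le_imp_le) (simp add: l2norm_nonneg)
  qed
  have L_zero: "L (restr {} z) = (\<lambda>j. 0)"
  proof -
    have "restr {} z = (\<lambda>i. 0 * restr {} z i)" by (simp add: restr_def)
    moreover have "L (\<lambda>i. 0 * restr {} z i) = (\<lambda>j. 0 * L (restr {} z) j)"
      using L restr_arrays[of "{}" I z] unfolding linear_operator_def by blast
    ultimately show ?thesis by simp
  qed
  have L_add: "L (restr (S \<union> S') z) = (\<lambda>j. L (restr S z) j + L (restr S' z) j)"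
    if "S \<subseteq> I" "S' \<subseteq> I" "S \<inter> S' = {}" for S S'
    using L restr_arrays[OF that(1)] restr_arrays[OF that(2)] restr_Un[OF that(3)]
    unfolding linear_operator_def by simp
  \<comment> \<open>The entry bound \<open>a / s\<close> on the tail, inherited from
    \<open>T\<close>, supplies the part of the sum over \<open>R\<close> that the tail
    lacks.\<close>
  have tail_sum: "sqrt s * (a / s) + (\<Sum>i\<in>R - T. cmod (z i)) / sqrt s
      = (\<Sum>i\<in>R. cmod (z i)) / sqrt s"
    unfolding a_def sum.subset_diff[OF T(1) finR] using s by (simp add: field_simps)
  have subR: "R - T \<subseteq> I" using R_def by auto
  \<comment> \<open>\<open>block_bound\<close> is applied twice to the same tail: here to the norm
    itself with \<open>K = 1\<close>, then to the norm after \<open>L\<close> with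
    \<open>K = sqrt 2\<close>.\<close>
  have tail2: "l2norm I (restr (R - T) z) \<le> 1 * (sqrt s * (a / s) + (\<Sum>i\<in>R - T. cmod (z i)) / sqrt s)"
  proof (rule block_bound)
    show "l2norm I (restr {} z) = 0" by (simp add: restr_def l2norm_def L2_set_def)
    show "l2norm I (restr (S \<union> S') z) \<le> l2norm I (restr S z) + l2norm I (restr S' z)"
      if "S \<inter> S' = {}" for S S'
      unfolding restr_Un[OF that] by (rule l2norm_triangle)
    show "l2norm I (restr S z) \<le> 1 * (sqrt s * M)"
      if "S \<subseteq> R - T" "card S \<le> s" "0 \<le> M" "\<And>i. i \<in> S \<Longrightarrow> cmod (z i) \<le> M" for S M
      using l2norm_restr_le[OF I _ that(2), of z M] that subR by auto
  qed (use finR s \<open>a \<ge> 0\<close> dom a_def in auto)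
  have tailL: "l2norm J (L (restr (R - T) z))
      \<le> sqrt 2 * (sqrt s * (a / s) + (\<Sum>i\<in>R - T. cmod (z i)) / sqrt s)"
  proof (rule block_bound)
    show "l2norm J (L (restr {} z)) = 0" by (simp add: L_zero l2norm_def L2_set_def)
    show "l2norm J (L (restr (S \<union> S') z)) \<le> l2norm J (L (restr S z)) + l2norm J (L (restr S' z))"
      if "S \<subseteq> R - T" "S' \<subseteq> R - T" "S \<inter> S' = {}" for S S'
      using that subR by (subst L_add) (auto intro: l2norm_triangle)
    show "l2norm J (L (restr S z)) \<le> sqrt 2 * (sqrt s * M)"
      if "S \<subseteq> R - T" "card S \<le> s" "0 \<le> M" "\<And>i. i \<in> S \<Longrightarrow> cmod (z i) \<le> M" for S M
    proof -
      have "l2norm J (L (restr S z)) \<le> sqrt 2 * l2norm I (restr S z)"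
        using that subR by (intro upper) auto
      also have "\<dots> \<le> sqrt 2 * (sqrt s * M)"
        using that subR by (intro mult_left_mono l2norm_restr_le I) auto
      finally show ?thesis .
    qed
  qed (use finR s \<open>a \<ge> 0\<close> dom a_def in auto)
  have T0: "T0 \<subseteq> I" "card T0 \<le> 2 * s" "T0 \<inter> (R - T) = {}" "T0 \<union> (R - T) = I"
    using T b s finT by (auto simp: T0_def R_def card_insert_if)
  have "(1 - \<delta>) * (l2norm I (restr T0 z))\<^sup>2 \<le> (l2norm J (L (restr T0 z)))\<^sup>2"
    using rip restr_arrays[OF T0(1)] card[OF T0(1)] T0(2) unfolding RIP_def by force
  then have "(sqrt (1 - \<delta>) * l2norm I (restr T0 z))\<^sup>2 \<le> (l2norm J (L (restr T0 z)))\<^sup>2"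
    using \<delta> by (simp add: power_mult_distrib)
  then have low: "sqrt (1 - \<delta>) * l2norm I (restr T0 z) \<le> l2norm J (L (restr T0 z))"
    by (rule power2_le_imp_le) (simp add: l2norm_nonneg)
  have z_split: "z = (\<lambda>i. restr T0 z i + restr (R - T) z i)"
    using restr_Un[OF T0(3), of z] T0(4) restr_eq[OF z] by simp
  have Lz: "L z = (\<lambda>j. L (restr T0 z) j + L (restr (R - T) z) j)"
    using L_add[OF T0(1) subR T0(3)] T0(4) restr_eq[OF z] by simp
  have "L (restr T0 z) = (\<lambda>j. L z j + - L (restr (R - T) z) j)"
    by (simp add: Lz)
  then have "l2norm J (L (restr T0 z)) \<le> l2norm J (L z) + l2norm J (L (restr (R - T) z))"
    using l2norm_triangle[of J "L z" "\<lambda>j. - L (restr (R - T) z) j"] by (simp add: l2norm_minus)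
  moreover have "sqrt (1 - \<delta>) * l2norm I z
      \<le> sqrt (1 - \<delta>) * l2norm I (restr T0 z) + l2norm I (restr (R - T) z)"
  proof -
    have "l2norm I z \<le> l2norm I (restr T0 z) + l2norm I (restr (R - T) z)"
      using l2norm_triangle[of I "restr T0 z" "restr (R - T) z"] z_split by simp
    then have "sqrt (1 - \<delta>) * l2norm I z
        \<le> sqrt (1 - \<delta>) * (l2norm I (restr T0 z) + l2norm I (restr (R - T) z))"
      using \<delta> by (intro mult_left_mono) auto
    also have "\<dots> \<le> sqrt (1 - \<delta>) * l2norm I (restr T0 z) + 1 * l2norm I (restr (R - T) z)"
      unfolding distrib_left
      using \<delta> by (intro add_mono order_refl mult_right_mono) (auto simp: l2norm_nonneg)
    finally show ?thesis by simp
  qed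
  ultimately show ?thesis
    using low tail2 tailL unfolding tail_sum R_def[symmetric]
    by (simp add: add_divide_distrib algebra_simps)
qed

section \<open>Completeness of the discrete Haar system\<close>

text \<open>On a zero-based coordinate, a one-dimensional Haar function whose support has length \<open>2 * M\<close>.\<close>
definition haar_digit :: "nat \<Rightarrow> nat \<Rightarrow> nat \<Rightarrow> nat \<Rightarrow> real" where
  "haar_digit M b k p =
     (if p div (2 * M) = k then (if b = 0 then 1 else (- 1) ^ (p div M)) else 0)"

lemma abs_haar_digit: "\<bar>haar_digit M b k p\<bar> = haar_digit M 0 k p"
  by (simp add: haar_digit_def power_abs)

lemma two_power_split: "j < n \<Longrightarrow> (2::'a::comm_semiring_1) ^ n = 2 ^ j * (2 * 2 ^ (n - Suc j))"
  by (metis Suc_diff_Suc add_diff_inverse_nat less_imp_not_less power_Suc power_add)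

text \<open>Write \<open>p = q * (2 * M) + r\<close>. The argument of \<open>haar1\<close> is the
  integer \<open>q - k\<close> plus the fraction \<open>t = r / (2 * M)\<close>, so it lies in the
  unit interval iff \<open>q = k\<close>, and in its first half iff \<open>r < M\<close>. The parity
  of \<open>p div M\<close> records which half it is.\<close>

lemma haar1_eq_haar_digit:
  assumes "j < n"
  shows "haar1 b (2 ^ j * (real p / 2 ^ n) - real k) = haar_digit (2 ^ (n - Suc j)) b k p"
proof -
  define M :: nat where "M = 2 ^ (n - Suc j)"
  have M: "M > 0" by (simp add: M_def)
  define q r where "q = p div (2 * M)" and "r = p mod (2 * M)"
  have p: "p = q * (2 * M) + r" and r: "r < 2 * M"
    using M by (simp_all only: q_def r_def div_mult_mod_eq, simp)
  define t where "t = real r / real (2 * M)"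
  have t: "0 \<le> t" "t < 1" "t < 1/2 \<longleftrightarrow> r < M"
    using M r by (simp_all add: t_def field_simps)
  have "(2::real) ^ n = 2 ^ j * real (2 * M)"
    unfolding M_def using two_power_split[OF assms, where 'a = real] by simp
  then have "2 ^ j * (real p / 2 ^ n) = real p / real (2 * M)" by simp
  also have "\<dots> = real q + t"
    using M by (simp add: p t_def field_simps)
  finally have arg: "2 ^ j * (real p / 2 ^ n) - real k = real q - real k + t" by simp
  have "p div M = 2 * q + r div M"
    using M by (subst p) (simp add: mult.commute mult.left_commute)
  moreover have "r div M = (if r < M then 0 else 1)"
    using r M by (auto simp: div_nat_eqI)
  ultimately have sgn: "(- 1 :: real) ^ (p div M) = (if r < M then 1 else - 1)"
    by (simp add: power_add power_mult)
  consider "q = k" | "q < k" | "q > k" by linarith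
  then show ?thesis
  proof cases
    case 1
    then show ?thesis
      unfolding arg M_def[symmetric] haar1_def haar_digit_def q_def[symmetric] sgn
      using t by (auto simp: indicator_def)
  next
    case 2
    then have "real q - real k \<le> - 1" by linarith
    then have "real q - real k + t < 0" using t by linarith
    with 2 show ?thesis
      unfolding arg M_def[symmetric] haar1_def haar_digit_def q_def[symmetric]
      by (auto simp: indicator_def)
  next
    case 3
    then have "real q - real k \<ge> 1" by linarith
    then have "real q - real k + t \<ge> 1" using t by linarith
    with 3 show ?thesis
      unfolding arg M_def[symmetric] haar1_def haar_digit_def q_def[symmetric]
      by (auto simp: indicator_def)
  qed
qed

lemma grid_bound:
  assumes "\<alpha> \<in> grid d N" "i < d"
  shows "\<alpha> i - 1 < N" "1 \<le> \<alpha> i" "\<alpha> i \<le> N"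
proof -
  have "\<alpha> i \<in> {1..N}" using assms PiE_mem[of \<alpha> "{..<d}" "\<lambda>_. {1..N}" i] by (simp add: grid_def)
  then show "\<alpha> i - 1 < N" "1 \<le> \<alpha> i" "\<alpha> i \<le> N" by auto
qed

text \<open>Since \<open>2 * M\<close> is the side \<open>2 ^ n / 2 ^ j\<close> of the support, this
  merges the sampling factor \<open>N powr (- d / 2)\<close> with the wavelet normalisation: one
  over the square root of the number of grid points in the cube.\<close>

definition haar_weight :: "nat \<Rightarrow> nat \<Rightarrow> real" where
  "haar_weight d M = (2 * real M) powr (- real d / 2)"

lemma haar_array_Some:
  assumes "j < n" "\<alpha> \<in> grid d (2 ^ n)"
  shows "haar_array d n (Some (j, k, e)) \<alpha> = haar_weight d (2 ^ (n - Suc j)) *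
    (\<Prod>i<d. haar_digit (2 ^ (n - Suc j)) (e i) (k i) (\<alpha> i - 1))"
proof -
  have "haar1 (e i) (2 ^ j * ((real (\<alpha> i) - 1) / 2 ^ n) - real (k i))
      = haar_digit (2 ^ (n - Suc j)) (e i) (k i) (\<alpha> i - 1)" if "i < d" for i
  proof -
    \<comment> \<open>Grid coordinates start at 1, so the subtraction on naturals is not
      truncated.\<close>
    have "1 \<le> \<alpha> i" by (rule grid_bound(2)[OF assms(2) that])
    then have "real (\<alpha> i) - 1 = real (\<alpha> i - 1)" by simp
    then show ?thesis using haar1_eq_haar_digit[OF assms(1)] by presburger
  qed
  moreover have "(2 ^ n) powr (- real d / 2) * 2 powr (real j * real d / 2)
      = haar_weight d (2 ^ (n - Suc j))"
  proof -
    have "(2::real) ^ n = 2 powr real n" "2 * real (2 ^ (n - Suc j)) = 2 powr (real n - real j)"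
      using assms(1) by (simp_all add: powr_realpow powr_diff two_power_split[OF assms(1)])
    then show ?thesis
      by (simp add: haar_weight_def powr_powr flip: powr_add) (simp add: algebra_simps diff_divide_distrib)
  qed
  ultimately show ?thesis
    by (simp add: haar_array_def haar_fun_def haar_cube_def flip: mult.assoc)
qed

lemma haar_weight_square:
  assumes "M > 0"
  shows "haar_weight d M * haar_weight d M = (1 / (2 * real M)) ^ d"
proof -
  have "haar_weight d M * haar_weight d M = (2 * real M) powr (- real d)"
    by (simp add: haar_weight_def flip: powr_add)
  also have "\<dots> = (1 / (2 * real M)) ^ d"
    using assms by (simp add: powr_minus powr_realpow power_one_over inverse_eq_divide)
  finally show ?thesis .
qed

section \<open>Sums over scales, shifts and types\<close>

definition haar_types :: "nat \<Rightarrow> (nat \<Rightarrow> nat) set" where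
  "haar_types d = {e \<in> {..<d} \<rightarrow>\<^sub>E {0, 1}. \<exists>i<d. e i \<noteq> 0}"

lemma finite_haar_types: "finite (haar_types d)"
  by (rule finite_subset[of _ "{..<d} \<rightarrow>\<^sub>E {0, 1}"]) (auto simp: haar_types_def intro: finite_PiE)

lemma haar_labels_eq:
  "haar_labels d n = insert None
     (Some ` (SIGMA j:{..<n}. ({..<d} \<rightarrow>\<^sub>E {..<2 ^ j}) \<times> haar_types d))"
  by (auto simp: haar_labels_def haar_types_def image_iff)

lemma finite_shifts: "finite ({..<d :: nat} \<rightarrow>\<^sub>E {..<2 ^ j :: nat})"
  by (intro finite_PiE) auto

lemma finite_haar_labels: "finite (haar_labels d n)"
  unfolding haar_labels_eq
  by (intro finite.insertI finite_imageI finite_SigmaI finite_cartesian_product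
      finite_haar_types finite_shifts) auto

lemma sum_haar_wavelets:
  "(\<Sum>b\<in>haar_labels d n - {None}. f b) =
   (\<Sum>j<n. \<Sum>k\<in>{..<d} \<rightarrow>\<^sub>E {..<2 ^ j}. \<Sum>e\<in>haar_types d. f (Some (j, k, e)))"
proof -
  have "haar_labels d n - {None} = Some ` (SIGMA j:{..<n}. ({..<d} \<rightarrow>\<^sub>E {..<2 ^ j}) \<times> haar_types d)"
    unfolding haar_labels_eq by auto
  then show ?thesis
    by (simp add: sum.reindex sum.Sigma sum.cartesian_product finite_shifts finite_haar_types
        finite_cartesian_product split_def)
qed

text \<open>Adding the zero type back makes the index set a full product, over which sums of
  products factor coordinate by coordinate.\<close>

lemma sum_haar_types:
  fixes f :: "(nat \<Rightarrow> nat) \<Rightarrow> 'a::ab_group_add"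
  shows "(\<Sum>e\<in>haar_types d. f e) = (\<Sum>e\<in>{..<d} \<rightarrow>\<^sub>E {0, 1}. f e) - f (\<lambda>i\<in>{..<d}. 0)"
proof -
  have "{..<d} \<rightarrow>\<^sub>E {0, 1} = insert (\<lambda>i\<in>{..<d}. 0) (haar_types d)"
  proof (intro equalityI subsetI)
    fix e :: "nat \<Rightarrow> nat" assume e: "e \<in> {..<d} \<rightarrow>\<^sub>E {0, 1}"
    show "e \<in> insert (\<lambda>i\<in>{..<d}. 0) (haar_types d)"
    proof (cases "\<exists>i<d. e i \<noteq> 0")
      case False
      then have "e = (\<lambda>i\<in>{..<d}. 0)"
        using e by (auto simp: fun_eq_iff PiE_iff extensional_def)
      then show ?thesis by simp
    qed (use e in \<open>simp add: haar_types_def\<close>)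
  next
    fix e assume "e \<in> insert (\<lambda>i\<in>{..<d}. 0) (haar_types d)"
    then show "e \<in> {..<d} \<rightarrow>\<^sub>E {0, 1}"
      by (rule insertE) (simp_all add: haar_types_def PiE_iff)
  qed
  moreover have "(\<lambda>i\<in>{..<d}. 0) \<notin> haar_types d" by (simp add: haar_types_def)
  ultimately show ?thesis using finite_haar_types by simp
qed

text \<open>Only the cell containing \<open>p\<close> can contribute, and the assumption puts its
  index below \<open>R\<close>.\<close>

lemma sum_haar_digit_0:
  assumes "p < R * (2 * M)"
  shows "(\<Sum>k<R. haar_digit M 0 k p * haar_digit M 0 k q) =
    of_bool (p div (2 * M) = q div (2 * M))"
proof -
  have "p div (2 * M) < R" using assms by (simp add: less_mult_imp_div_less)
  moreover have "(\<Sum>k<R. haar_digit M 0 k p * haar_digit M 0 k q) =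
    (\<Sum>k<R. if k = p div (2 * M) then of_bool (p div (2 * M) = q div (2 * M)) else 0)"
    by (intro sum.cong) (auto simp: haar_digit_def)
  ultimately show ?thesis by simp
qed

text \<open>Inside a common cell the two types contribute 1 and a sign: they add up to 2 in the same
  half and cancel in opposite halves. Allowing both types thus halves the cells.\<close>

lemma sum_haar_digit:
  assumes "p < R * (2 * M)"
  shows "(\<Sum>k<R. \<Sum>b\<in>{0, 1}. haar_digit M b k p * haar_digit M b k q) =
    2 * of_bool (p div M = q div M)"
proof -
  define c where "c = p div M" define c' where "c' = q div M"
  have half: "p div (2 * M) = c div 2" "q div (2 * M) = c' div 2"
    by (simp_all add: c_def c'_def div_mult2_eq mult.commute flip: div_mult2_eq)
  have "c div 2 < R" using assms half by (simp add: less_mult_imp_div_less flip: half)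
  moreover have "(\<Sum>k<R. \<Sum>b\<in>{0, 1}. haar_digit M b k p * haar_digit M b k q) =
    (\<Sum>k<R. if k = c div 2 then 2 * of_bool (c = c') else 0)"
  proof (intro sum.cong refl)
    fix k
    have parity: "c = c'" if "c div 2 = c' div 2" "even c \<longleftrightarrow> even c'"
      using that by (metis div_mult_mod_eq parity_cases)
    show "(\<Sum>b\<in>{0, 1}. haar_digit M b k p * haar_digit M b k q) =
        (if k = c div 2 then 2 * of_bool (c = c') else 0)"
      using parity
      by (cases "even c"; cases "even c'")
        (auto simp: haar_digit_def half c_def[symmetric] c'_def[symmetric])
  qed
  ultimately show ?thesis by (simp add: c_def c'_def)
qed

text \<open>The kernel of the orthogonal projection onto arrays constant on dyadic cubes of side
  \<open>N / 2 ^ j\<close>; consecutive kernels differ by the wavelets of one scale.\<close>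
definition cube_kernel :: "nat \<Rightarrow> nat \<Rightarrow> nat \<Rightarrow> (nat \<Rightarrow> nat) \<Rightarrow> (nat \<Rightarrow> nat) \<Rightarrow> real" where
  "cube_kernel d n j \<alpha> \<beta> = (\<Prod>i<d. 1 / 2 ^ (n - j) *
     of_bool ((\<alpha> i - 1) div 2 ^ (n - j) = (\<beta> i - 1) div 2 ^ (n - j)))"

text \<open>With all types allowed, the sum factors into \<open>sum_haar_digit\<close> in each
  coordinate and detects a common cube of side \<open>M\<close>. The zero type alone detects a
  common cube of side \<open>2 * M\<close> and is subtracted. The squared weight turns both into
  kernels.\<close>

lemma haar_scale_kernel:
  assumes j: "j < n" and \<alpha>: "\<alpha> \<in> grid d (2 ^ n)" and \<beta>: "\<beta> \<in> grid d (2 ^ n)"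
  shows "(\<Sum>k\<in>{..<d} \<rightarrow>\<^sub>E {..<2 ^ j}. \<Sum>e\<in>haar_types d.
      haar_array d n (Some (j, k, e)) \<alpha> * haar_array d n (Some (j, k, e)) \<beta>) =
    cube_kernel d n (Suc j) \<alpha> \<beta> - cube_kernel d n j \<alpha> \<beta>"
proof -
  define M :: nat where "M = 2 ^ (n - Suc j)"
  define g where "g b k i = haar_digit M b k (\<alpha> i - 1) * haar_digit M b k (\<beta> i - 1)" for b k i
  have N: "2 ^ j * (2 * M) = 2 ^ n"
    unfolding M_def using two_power_split[OF j, where 'a = nat] by simp
  have twoM: "(2::real) ^ (n - j) = 2 * real M" "2 ^ (n - j) = 2 * M"
    unfolding M_def Suc_diff_Suc[OF j, symmetric] by simp_all
  have p: "\<alpha> i - 1 < 2 ^ j * (2 * M)" if "i < d" for i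
    unfolding N using grid_bound(1)[OF \<alpha> that] .
  have wsq: "haar_weight d M * haar_weight d M = (\<Prod>i<d. 1 / (2 * real M))"
    using haar_weight_square[of M d] by (simp add: M_def)
  have product: "haar_array d n (Some (j, k, e)) \<alpha> * haar_array d n (Some (j, k, e)) \<beta> =
      haar_weight d M * haar_weight d M * (\<Prod>i<d. g (e i) (k i) i)" for k e
    unfolding haar_array_Some[OF j \<alpha>] haar_array_Some[OF j \<beta>] M_def[symmetric] g_def prod.distrib
    by (simp only: ac_simps)
  have all_types: "(\<Sum>k\<in>{..<d} \<rightarrow>\<^sub>E {..<2 ^ j}. \<Sum>e\<in>{..<d} \<rightarrow>\<^sub>E {0, 1}. \<Prod>i<d. g (e i) (k i) i) =
      (\<Prod>i<d. 2 * of_bool ((\<alpha> i - 1) div M = (\<beta> i - 1) div M))"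
  proof -
    have "(\<Sum>k\<in>{..<d} \<rightarrow>\<^sub>E {..<2 ^ j}. \<Sum>e\<in>{..<d} \<rightarrow>\<^sub>E {0, 1}. \<Prod>i<d. g (e i) (k i) i) =
      (\<Sum>k\<in>{..<d} \<rightarrow>\<^sub>E {..<2 ^ j}. \<Prod>i<d. \<Sum>b\<in>{0, 1}. g b (k i) i)"
      by (intro sum.cong refl) (subst prod_sum_PiE, auto)
    also have "\<dots> = (\<Prod>i<d. \<Sum>k<2 ^ j. \<Sum>b\<in>{0, 1}. g b k i)"
      by (subst prod_sum_PiE) auto
    also have "\<dots> = (\<Prod>i<d. 2 * of_bool ((\<alpha> i - 1) div M = (\<beta> i - 1) div M))"
      unfolding g_def by (intro prod.cong refl sum_haar_digit p) auto
    finally show ?thesis .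
  qed
  have zero_type: "(\<Sum>k\<in>{..<d} \<rightarrow>\<^sub>E {..<2 ^ j}. \<Prod>i<d. g ((\<lambda>i\<in>{..<d}. 0) i) (k i) i) =
      (\<Prod>i<d. of_bool ((\<alpha> i - 1) div (2 * M) = (\<beta> i - 1) div (2 * M)))"
  proof -
    have "(\<Sum>k\<in>{..<d} \<rightarrow>\<^sub>E {..<2 ^ j}. \<Prod>i<d. g ((\<lambda>i\<in>{..<d}. 0) i) (k i) i) =
      (\<Sum>k\<in>{..<d} \<rightarrow>\<^sub>E {..<2 ^ j}. \<Prod>i<d. g 0 (k i) i)"
      by (intro sum.cong prod.cong refl) auto
    also have "\<dots> = (\<Prod>i<d. \<Sum>k<2 ^ j. g 0 k i)"
      by (subst prod_sum_PiE) auto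
    also have "\<dots> = (\<Prod>i<d. of_bool ((\<alpha> i - 1) div (2 * M) = (\<beta> i - 1) div (2 * M)))"
      unfolding g_def by (intro prod.cong refl sum_haar_digit_0 p) auto
    finally show ?thesis .
  qed
  have "(\<Sum>k\<in>{..<d} \<rightarrow>\<^sub>E {..<2 ^ j}. \<Sum>e\<in>haar_types d.
      haar_array d n (Some (j, k, e)) \<alpha> * haar_array d n (Some (j, k, e)) \<beta>) =
    haar_weight d M * haar_weight d M *
      ((\<Sum>k\<in>{..<d} \<rightarrow>\<^sub>E {..<2 ^ j}. \<Sum>e\<in>{..<d} \<rightarrow>\<^sub>E {0, 1}. \<Prod>i<d. g (e i) (k i) i) -
       (\<Sum>k\<in>{..<d} \<rightarrow>\<^sub>E {..<2 ^ j}. \<Prod>i<d. g ((\<lambda>i\<in>{..<d}. 0) i) (k i) i))"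
    unfolding product sum_distrib_left[symmetric] sum_haar_types sum_subtractf by simp
  also have "\<dots> = cube_kernel d n (Suc j) \<alpha> \<beta> - cube_kernel d n j \<alpha> \<beta>"
    unfolding all_types zero_type wsq right_diff_distrib prod.distrib[symmetric]
      cube_kernel_def twoM M_def[symmetric]
    by (intro arg_cong2[of _ _ _ _ "(-)"] prod.cong refl) (simp_all add: M_def)
  finally show ?thesis .
qed

text \<open>The constant array gives the kernel of scale 0 and the wavelets of each scale give an
  increment, so the sum telescopes to scale \<open>n\<close>, where the cubes are single
  points.\<close>

lemma haar_complete:
  assumes \<alpha>: "\<alpha> \<in> grid d (2 ^ n)" and \<beta>: "\<beta> \<in> grid d (2 ^ n)"
  shows "(\<Sum>b\<in>haar_labels d n. haar_array d n b \<alpha> * haar_array d n b \<beta>) = of_bool (\<alpha> = \<beta>)"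
proof -
  have None: "haar_array d n None \<alpha> * haar_array d n None \<beta> = cube_kernel d n 0 \<alpha> \<beta>"
  proof -
    have "(\<alpha> i - 1) div 2 ^ n = (\<beta> i - 1) div 2 ^ n" if "i < d" for i
      using grid_bound(1)[OF \<alpha> that] grid_bound(1)[OF \<beta> that] by simp
    then have "cube_kernel d n 0 \<alpha> \<beta> = (1 / 2 ^ n) ^ d"
      by (simp add: cube_kernel_def)
    moreover have "haar_array d n None \<alpha> * haar_array d n None \<beta> = (2 ^ n) powr (- real d)"
      by (simp add: haar_array_def flip: powr_add)
    ultimately show ?thesis
      by (simp add: powr_minus powr_realpow power_divide divide_inverse power_inverse)
  qed
  have "(\<Sum>b\<in>haar_labels d n - {None}. haar_array d n b \<alpha> * haar_array d n b \<beta>) =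
    (\<Sum>j<n. cube_kernel d n (Suc j) \<alpha> \<beta> - cube_kernel d n j \<alpha> \<beta>)"
    unfolding sum_haar_wavelets by (intro sum.cong refl haar_scale_kernel \<alpha> \<beta>) auto
  also have "\<dots> = cube_kernel d n n \<alpha> \<beta> - cube_kernel d n 0 \<alpha> \<beta>"
    by (rule sum_lessThan_telescope)
  finally have "(\<Sum>b\<in>haar_labels d n. haar_array d n b \<alpha> * haar_array d n b \<beta>) = cube_kernel d n n \<alpha> \<beta>"
    using None sum.remove[OF finite_haar_labels, of None d n "\<lambda>b. haar_array d n b \<alpha> * haar_array d n b \<beta>"]
    by (simp add: haar_labels_def)
  also have "\<dots> = of_bool (\<forall>i<d. \<alpha> i - 1 = \<beta> i - 1)"
    by (auto simp: cube_kernel_def)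
  also have "(\<forall>i<d. \<alpha> i - 1 = \<beta> i - 1) \<longleftrightarrow> \<alpha> = \<beta>"
  proof
    assume eq: "\<forall>i<d. \<alpha> i - 1 = \<beta> i - 1"
    show "\<alpha> = \<beta>"
    \<comment> \<open>Members of the grid are determined by their first \<open>d\<close>
      coordinates, and subtracting 1 is injective on these because they are at least 1.\<close>
    proof (rule PiE_ext)
      show "\<alpha> \<in> {..<d} \<rightarrow>\<^sub>E {1..2 ^ n}" "\<beta> \<in> {..<d} \<rightarrow>\<^sub>E {1..2 ^ n}"
        using \<alpha> \<beta> by (simp_all add: grid_def)
      show "\<alpha> i = \<beta> i" if "i \<in> {..<d}" for i
        using eq grid_bound(2)[OF \<alpha>, of i] grid_bound(2)[OF \<beta>, of i] that
        by (metis eq_diff_iff lessThan_iff)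
    qed
  qed auto
  finally show ?thesis .
qed

section \<open>Inversion formula and Parseval identity\<close>

lemma finite_grid: "finite (grid d N)"
  unfolding grid_def by (intro finite_PiE) auto

lemma haar_adjoint_transform:
  assumes "x \<in> arrays (grid d (2 ^ n))"
  shows "haar_adjoint d n (haar_transform d n x) = x"
proof
  fix \<alpha>
  show "haar_adjoint d n (haar_transform d n x) \<alpha> = x \<alpha>"
  proof (cases "\<alpha> \<in> grid d (2 ^ n)")
    case False
    then show ?thesis using assms by (simp add: haar_adjoint_def arrays_def)
  next
    case True
    have "haar_adjoint d n (haar_transform d n x) \<alpha> = (\<Sum>b\<in>haar_labels d n. \<Sum>\<beta>\<in>grid d (2 ^ n).
        x \<beta> * of_real (haar_array d n b \<beta> * haar_array d n b \<alpha>))"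
      using True by (simp add: haar_adjoint_def haar_transform_def sum_distrib_right mult.assoc)
    also have "\<dots> = (\<Sum>\<beta>\<in>grid d (2 ^ n). x \<beta> *
        of_real (\<Sum>b\<in>haar_labels d n. haar_array d n b \<beta> * haar_array d n b \<alpha>))"
      by (subst sum.swap) (simp add: sum_distrib_left)
    also have "\<dots> = (\<Sum>\<beta>\<in>grid d (2 ^ n). x \<beta> * of_real (of_bool (\<beta> = \<alpha>)))"
      by (intro sum.cong refl) (simp add: haar_complete[OF _ True])
    also have "\<dots> = (\<Sum>\<beta>\<in>grid d (2 ^ n). if \<beta> = \<alpha> then x \<beta> else 0)"
      by (intro sum.cong) auto
    also have "\<dots> = x \<alpha>"
      using True finite_grid by simp
    finally show ?thesis .
  qed
qed

text \<open>Taking \<open>z\<close> to be the transform of \<open>x\<close> itself in the adjoint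
  identity, inversion turns the right-hand side into the squared norm of \<open>x\<close>.\<close>

lemma l2norm_haar_transform:
  assumes "x \<in> arrays (grid d (2 ^ n))"
  shows "l2norm (haar_labels d n) (haar_transform d n x) = l2norm (grid d (2 ^ n)) x"
proof -
  have "complex_of_real (\<Sum>b\<in>haar_labels d n. (cmod (haar_transform d n x b))\<^sup>2) =
      of_real (\<Sum>\<alpha>\<in>grid d (2 ^ n). (cmod (x \<alpha>))\<^sup>2)"
    using haar_adjoint_works[where z = "haar_transform d n x" and x = x and d = d and n = n]
    by (simp only: of_real_sum complex_norm_square haar_adjoint_transform[OF assms])
  then show ?thesis
    by (simp only: of_real_eq_iff l2norm_def L2_set_def)
qed

section \<open>The Haar coefficients and the total variation\<close>

lemma norm_diff_le_sum_steps:
  fixes y :: "nat \<Rightarrow> 'a::real_normed_vector"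
  shows "norm (y a - y (a + M)) \<le> (\<Sum>q\<in>{a..<a + M}. norm (y (Suc q) - y q))"
proof -
  have "norm (y a - y (a + M)) = norm (\<Sum>q\<in>{a..<a + M}. y (Suc q) - y q)"
    by (simp add: sum_Suc_diff' norm_minus_commute)
  also have "\<dots> \<le> (\<Sum>q\<in>{a..<a + M}. norm (y (Suc q) - y q))"
    by (rule norm_sum)
  finally show ?thesis .
qed

text \<open>The two halves of each cell carry opposite signs, so their entries are compared at distance \<open>M\<close>.\<close>
lemma haar_digit_variation:
  fixes y :: "nat \<Rightarrow> complex"
  assumes "M > 0" "b \<noteq> 0"
  shows "(\<Sum>k<R. cmod (\<Sum>p<R * (2 * M). y p * of_real (haar_digit M b k p))) \<le>
    real M * (\<Sum>p<R * (2 * M). if Suc p < R * (2 * M) then cmod (y (Suc p) - y p) else 0)"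
proof -
  define D where "D p = (if Suc p < R * (2 * M) then cmod (y (Suc p) - y p) else 0)" for p
  have "cmod (\<Sum>p<R * (2 * M). y p * of_real (haar_digit M b k p))
      \<le> real M * sum D {k * (2 * M)..<k * (2 * M) + 2 * M}" if "k < R" for k
  proof -
    define c where "c = k * (2 * M)"
    have "Suc k * (2 * M) \<le> R * (2 * M)" using that by (intro mult_le_mono1) auto
    then have cR: "c + 2 * M \<le> R * (2 * M)" by (simp add: c_def)
    have first: "haar_digit M b k (c + t) = 1" if "t < M" for t
    proof -
      have "(c + t) div M = 2 * k" "(c + t) div (2 * M) = k"
        using that by (auto intro!: div_nat_eqI simp: c_def algebra_simps)
      then show ?thesis using assms by (simp add: haar_digit_def)
    qed
    have second: "haar_digit M b k (c + t + M) = - 1" if "t < M" for t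
    proof -
      have "(c + t + M) div M = Suc (2 * k)" "(c + t + M) div (2 * M) = k"
        using that by (auto intro!: div_nat_eqI simp: c_def algebra_simps)
      then show ?thesis using assms by (simp add: haar_digit_def)
    qed
    have cell: "c \<le> p \<and> p < c + 2 * M" if "haar_digit M b k p \<noteq> 0" for p
    proof -
      have "p div (2 * M) = k" using that by (auto simp: haar_digit_def split: if_splits)
      then show ?thesis
        using assms(1) dividend_less_div_times[of "2 * M" p] div_times_less_eq_dividend[of p "2 * M"]
        by (auto simp: c_def)
    qed
    have "(\<Sum>p<R * (2 * M). y p * of_real (haar_digit M b k p)) =
        (\<Sum>p\<in>{c..<c + 2 * M}. y p * of_real (haar_digit M b k p))"
      using cR cell by (intro sum.mono_neutral_right) force+
    also have "\<dots> = (\<Sum>t<2 * M. y (c + t) * of_real (haar_digit M b k (c + t)))"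
      using sum.shift_bounds_nat_ivl[of "\<lambda>p. y p * of_real (haar_digit M b k p)" 0 c "2 * M"]
      by (simp add: add.commute atLeast0LessThan)
    also have "\<dots> = (\<Sum>t<M. y (c + t) * of_real (haar_digit M b k (c + t))) +
        (\<Sum>t<M. y (c + t + M) * of_real (haar_digit M b k (c + t + M)))"
      using sum.nat_group[of "\<lambda>t. y (c + t) * of_real (haar_digit M b k (c + t))" M 2]
        sum.shift_bounds_nat_ivl[of "\<lambda>t. y (c + t) * of_real (haar_digit M b k (c + t))" 0 M M]
      by (simp add: numeral_2_eq_2 atLeast0LessThan add.assoc)
    also have "\<dots> = (\<Sum>t<M. y (c + t) - y (c + t + M))"
      by (simp add: first second sum_subtractf sum_negf)
    finally have "cmod (\<Sum>p<R * (2 * M). y p * of_real (haar_digit M b k p))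
        \<le> (\<Sum>t<M. cmod (y (c + t) - y (c + t + M)))"
      by (simp add: norm_sum)
    \<comment> \<open>Each of the \<open>M\<close> pairs is bounded by the variation of the whole
      cell; this is the source of the factor \<open>M\<close>.\<close>
    also have "\<dots> \<le> (\<Sum>t<M. sum D {c..<c + 2 * M})"
    proof (intro sum_mono)
      fix t assume t: "t \<in> {..<M}"
      have "cmod (y (c + t) - y (c + t + M))
          \<le> (\<Sum>q\<in>{c + t..<c + t + M}. cmod (y (Suc q) - y q))"
        by (rule norm_diff_le_sum_steps)
      \<comment> \<open>These steps end at \<open>c + t + M < c + 2 * M\<close>, so none of them
        starts at the last index of the range, where \<open>D\<close> is 0 by default.\<close>
      also have "\<dots> = sum D {c + t..<c + t + M}"
        using cR t by (intro sum.cong) (auto simp: D_def)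
      also have "\<dots> \<le> sum D {c..<c + 2 * M}"
        using t by (intro sum_mono2) (auto simp: D_def)
      finally show "cmod (y (c + t) - y (c + t + M)) \<le> sum D {c..<c + 2 * M}" .
    qed
    also have "\<dots> = real M * sum D {c..<c + 2 * M}" by simp
    finally show ?thesis by (simp add: c_def)
  qed
  then have "(\<Sum>k<R. cmod (\<Sum>p<R * (2 * M). y p * of_real (haar_digit M b k p)))
      \<le> (\<Sum>k<R. real M * sum D {k * (2 * M)..<k * (2 * M) + 2 * M})"
    by (intro sum_mono) auto
  \<comment> \<open>The cells tile the range, so their variations add up to that of the whole
    line.\<close>
  also have "\<dots> = real M * sum D {..<R * (2 * M)}"
    by (simp only: sum_distrib_left[symmetric] sum.nat_group)
  finally show ?thesis by (simp add: D_def)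
qed

section \<open>Slicing the grid into lines along one coordinate\<close>

lemma sum_PiE_split:
  assumes "i \<in> A"
  shows "(\<Sum>f\<in>PiE A B. g f) = (\<Sum>f\<in>PiE (A - {i}) B. \<Sum>y\<in>B i. g (f(i := y)))"
proof -
  have "PiE A B = (\<lambda>(y, f). f(i := y)) ` (B i \<times> PiE (A - {i}) B)"
    using PiE_insert_eq[of i "A - {i}" B] assms by (simp add: insert_absorb)
  moreover have "inj_on (\<lambda>(y, f). f(i := y)) (B i \<times> PiE (A - {i}) B)"
    by (rule inj_combinator) auto
  ultimately have "(\<Sum>f\<in>PiE A B. g f) = (\<Sum>(y, f)\<in>B i \<times> PiE (A - {i}) B. g (f(i := y)))"
    by (simp add: sum.reindex split_def)
  also have "\<dots> = (\<Sum>f\<in>PiE (A - {i}) B. \<Sum>y\<in>B i. g (f(i := y)))"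
    by (simp add: sum.cartesian_product[symmetric]) (rule sum.swap)
  finally show ?thesis .
qed

lemma sum_grid_split:
  assumes "i < d"
  shows "(\<Sum>\<alpha>\<in>grid d N. g \<alpha>) = (\<Sum>\<alpha>\<in>({..<d} - {i}) \<rightarrow>\<^sub>E {1..N}. \<Sum>p\<in>{1..N}. g (\<alpha>(i := p)))"
  unfolding grid_def using assms by (intro sum_PiE_split) simp

text \<open>Choose a coordinate \<open>i\<close> with \<open>e i \<noteq> 0\<close> and slice the
  grid into lines along it. \<open>haar_digit_variation\<close> handles each line. In the other
  coordinates signs are discarded, and summing over shifts gives 1 because the cells partition the
  range. The lines together give the part of the total variation in direction
  \<open>i\<close>.\<close>

lemma haar_coefficients_scale_type:
  assumes j: "j < n" and e: "e \<in> haar_types d"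
  defines "M \<equiv> (2::nat) ^ (n - Suc j)"
  shows "(\<Sum>k\<in>{..<d} \<rightarrow>\<^sub>E {..<2 ^ j}. cmod (haar_transform d n x (Some (j, k, e)))) \<le>
    haar_weight d M * real M * TV1 d (2 ^ n) x"
proof -
  obtain i where i: "i < d" "e i \<noteq> 0" using e by (auto simp: haar_types_def)
  have M: "M > 0" by (simp add: M_def)
  have N: "2 ^ j * (2 * M) = 2 ^ n"
    unfolding M_def using two_power_split[OF j, where 'a = nat] by simp
  define G where "G = ({..<d} - {i}) \<rightarrow>\<^sub>E {1..2 ^ n :: nat}"
  \<comment> \<open>The unweighted one-dimensional coefficient, in modulus, of the line through
    \<open>\<alpha>\<close> at cell \<open>\<kappa>\<close>.\<close>
  define c where "c \<alpha> \<kappa> = cmod (\<Sum>p\<in>{1..2 ^ n}. x (\<alpha>(i := p)) * of_real (haar_digit M (e i) \<kappa> (p - 1)))"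
    for \<alpha> \<kappa>
  have w: "haar_weight d M \<ge> 0" by (simp add: haar_weight_def)
  note grid_split = sum_grid_split[OF i(1), of _ "2 ^ n", folded G_def]
  \<comment> \<open>The bound is a product over all \<open>d\<close> coordinates, with
    \<open>c\<close> in place of the factor at \<open>i\<close>, so that the sum over shifts can
    factor later.\<close>
  have coeff: "cmod (haar_transform d n x (Some (j, k, e))) \<le> haar_weight d M *
      (\<Sum>\<alpha>\<in>G. \<Prod>l<d. if l = i then c \<alpha> (k i) else haar_digit M 0 (k l) (\<alpha> l - 1))"
    if k: "k \<in> {..<d} \<rightarrow>\<^sub>E {..<2 ^ j}" for k
  proof -
    have "Some (j, k, e) \<in> haar_labels d n"
      using j k e by (auto simp: haar_labels_eq)
    then have "haar_transform d n x (Some (j, k, e)) =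
        (\<Sum>\<alpha>\<in>grid d (2 ^ n). of_real (haar_weight d M) *
           (x \<alpha> * of_real (\<Prod>l<d. haar_digit M (e l) (k l) (\<alpha> l - 1))))"
      unfolding haar_transform_def
      by (simp only: if_True complex_cnj_complex_of_real)
        (intro sum.cong refl, simp add: haar_array_Some[OF j] M_def)
    also have "\<dots> = of_real (haar_weight d M) *
        (\<Sum>\<alpha>\<in>G. \<Sum>p\<in>{1..2 ^ n}. x (\<alpha>(i := p)) *
           of_real (\<Prod>l<d. haar_digit M (e l) (k l) ((\<alpha>(i := p)) l - 1)))"
      by (simp only: sum_distrib_left[symmetric] grid_split)
    also have "\<dots> = of_real (haar_weight d M) *
        (\<Sum>\<alpha>\<in>G. of_real (\<Prod>l\<in>{..<d} - {i}. haar_digit M (e l) (k l) (\<alpha> l - 1)) *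
           (\<Sum>p\<in>{1..2 ^ n}. x (\<alpha>(i := p)) * of_real (haar_digit M (e i) (k i) (p - 1))))"
    proof -
      have "(\<Prod>l<d. haar_digit M (e l) (k l) ((\<alpha>(i := p)) l - 1)) =
          haar_digit M (e i) (k i) (p - 1) * (\<Prod>l\<in>{..<d} - {i}. haar_digit M (e l) (k l) (\<alpha> l - 1))"
        for \<alpha> p
        using i by (subst prod.remove[of _ i]) (auto intro!: prod.cong)
      then show ?thesis
        by (simp only: sum_distrib_left of_real_mult ac_simps)
    qed
    finally have "cmod (haar_transform d n x (Some (j, k, e))) = haar_weight d M * cmod
        (\<Sum>\<alpha>\<in>G. of_real (\<Prod>l\<in>{..<d} - {i}. haar_digit M (e l) (k l) (\<alpha> l - 1)) *
           (\<Sum>p\<in>{1..2 ^ n}. x (\<alpha>(i := p)) * of_real (haar_digit M (e i) (k i) (p - 1))))"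
      using w by (simp only: norm_mult norm_of_real abs_of_nonneg)
    also have "\<dots> \<le> haar_weight d M *
        (\<Sum>\<alpha>\<in>G. cmod (of_real (\<Prod>l\<in>{..<d} - {i}. haar_digit M (e l) (k l) (\<alpha> l - 1)) *
           (\<Sum>p\<in>{1..2 ^ n}. x (\<alpha>(i := p)) * of_real (haar_digit M (e i) (k i) (p - 1)))))"
      by (intro mult_left_mono norm_sum w)
    also have "\<dots> = haar_weight d M *
        (\<Sum>\<alpha>\<in>G. (\<Prod>l\<in>{..<d} - {i}. haar_digit M 0 (k l) (\<alpha> l - 1)) * c \<alpha> (k i))"
      by (simp only: norm_mult norm_of_real abs_prod abs_haar_digit c_def)
    also have "\<dots> = haar_weight d M *
        (\<Sum>\<alpha>\<in>G. \<Prod>l<d. if l = i then c \<alpha> (k i) else haar_digit M 0 (k l) (\<alpha> l - 1))"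
    proof -
      have "(\<Prod>l<d. if l = i then c \<alpha> (k i) else haar_digit M 0 (k l) (\<alpha> l - 1)) =
          (\<Prod>l\<in>{..<d} - {i}. haar_digit M 0 (k l) (\<alpha> l - 1)) * c \<alpha> (k i)" for \<alpha>
        using i by (subst prod.remove[of _ i]) (auto intro!: prod.cong)
      then show ?thesis by simp
    qed
    finally show ?thesis .
  qed
  have line: "(\<Sum>\<kappa><2 ^ j. c \<alpha> \<kappa>) \<le> real M * (\<Sum>p\<in>{1..2 ^ n}. cmod (grad (2 ^ n) x (\<alpha>(i := p)) i))"
    for \<alpha>
  proof -
    note shift = sum.atLeast1_atMost_eq[of _ "2 ^ n", folded One_nat_def]
    \<comment> \<open>The index \<open>p\<close> stands for the coordinate \<open>Suc p\<close>; the
      cutoff \<open>Suc p < 2 ^ n\<close> is then the boundary case of \<open>grad\<close>.\<close>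
    have "(\<Sum>\<kappa><2 ^ j. c \<alpha> \<kappa>) \<le> real M * (\<Sum>p<2 ^ n. if Suc p < 2 ^ n then
        cmod (x (\<alpha>(i := Suc (Suc p))) - x (\<alpha>(i := Suc p))) else 0)"
      using haar_digit_variation[OF M i(2), where R = "2 ^ j" and y = "\<lambda>p. x (\<alpha>(i := Suc p))"]
      by (simp only: N c_def shift diff_Suc_1)
    also have "\<dots> = real M * (\<Sum>p\<in>{1..2 ^ n}. cmod (grad (2 ^ n) x (\<alpha>(i := p)) i))"
      unfolding shift by (intro arg_cong2[of _ _ _ _ "(*)"] sum.cong refl) (simp add: grad_def)
    finally show ?thesis .
  qed
  \<comment> \<open>Where \<open>l = i\<close>, the shift \<open>k i\<close> can be read as
    \<open>k l\<close>. Each factor then depends on its own coordinate of \<open>k\<close> only, and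
    the sum over shifts becomes a product of sums.\<close>
  have collapse: "(\<Sum>k\<in>{..<d} \<rightarrow>\<^sub>E {..<2 ^ j}.
      \<Prod>l<d. if l = i then c \<alpha> (k i) else haar_digit M 0 (k l) (\<alpha> l - 1)) = (\<Sum>\<kappa><2 ^ j. c \<alpha> \<kappa>)"
    if \<alpha>: "\<alpha> \<in> G" for \<alpha>
  proof -
    have "(\<Sum>k\<in>{..<d} \<rightarrow>\<^sub>E {..<2 ^ j}.
        \<Prod>l<d. if l = i then c \<alpha> (k i) else haar_digit M 0 (k l) (\<alpha> l - 1)) =
      (\<Sum>k\<in>{..<d} \<rightarrow>\<^sub>E {..<2 ^ j}.
        \<Prod>l<d. if l = i then c \<alpha> (k l) else haar_digit M 0 (k l) (\<alpha> l - 1))"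
      by (intro sum.cong prod.cong refl) auto
    also have "\<dots> = (\<Prod>l<d. \<Sum>\<kappa><2 ^ j. if l = i then c \<alpha> \<kappa> else haar_digit M 0 \<kappa> (\<alpha> l - 1))"
      by (subst prod_sum_PiE) auto
    also have "\<dots> = (\<Prod>l<d. if l = i then (\<Sum>\<kappa><2 ^ j. c \<alpha> \<kappa>) else 1)"
    proof (intro prod.cong refl)
      fix l assume l: "l \<in> {..<d}"
      show "(\<Sum>\<kappa><2 ^ j. if l = i then c \<alpha> \<kappa> else haar_digit M 0 \<kappa> (\<alpha> l - 1)) =
          (if l = i then (\<Sum>\<kappa><2 ^ j. c \<alpha> \<kappa>) else 1)"
      proof (cases "l = i")
        case False
        then have "\<alpha> l \<in> {1..2 ^ n}" using \<alpha> l unfolding G_def by (intro PiE_mem[of \<alpha>]) auto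
        then have "\<alpha> l - 1 < 2 ^ j * (2 * M)" unfolding N by auto
        \<comment> \<open>An indicator equals its square, so \<open>sum_haar_digit_0\<close> with
          both points equal shows that exactly one cell contains the point.\<close>
        moreover have idem: "haar_digit M 0 \<kappa> (\<alpha> l - 1) * haar_digit M 0 \<kappa> (\<alpha> l - 1) =
            haar_digit M 0 \<kappa> (\<alpha> l - 1)" for \<kappa>
          by (simp add: haar_digit_def)
        ultimately have "(\<Sum>\<kappa><2 ^ j. haar_digit M 0 \<kappa> (\<alpha> l - 1)) = 1"
          using sum_haar_digit_0[of "\<alpha> l - 1" "2 ^ j" M "\<alpha> l - 1"] by (simp only: idem) simp
        with False show ?thesis by simp
      qed simp
    qed
    also have "\<dots> = (\<Sum>\<kappa><2 ^ j. c \<alpha> \<kappa>)"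
      using i by (simp add: prod.delta)
    finally show ?thesis .
  qed
  have "(\<Sum>k\<in>{..<d} \<rightarrow>\<^sub>E {..<2 ^ j}. cmod (haar_transform d n x (Some (j, k, e)))) \<le>
      (\<Sum>k\<in>{..<d} \<rightarrow>\<^sub>E {..<2 ^ j}. haar_weight d M *
      (\<Sum>\<alpha>\<in>G. \<Prod>l<d. if l = i then c \<alpha> (k i) else haar_digit M 0 (k l) (\<alpha> l - 1)))"
    by (intro sum_mono coeff)
  also have "\<dots> = haar_weight d M * (\<Sum>\<alpha>\<in>G. \<Sum>k\<in>{..<d} \<rightarrow>\<^sub>E {..<2 ^ j}.
      \<Prod>l<d. if l = i then c \<alpha> (k i) else haar_digit M 0 (k l) (\<alpha> l - 1))"
    by (simp only: sum_distrib_left[symmetric]) (subst sum.swap, rule refl)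
  also have "\<dots> = haar_weight d M * (\<Sum>\<alpha>\<in>G. \<Sum>\<kappa><2 ^ j. c \<alpha> \<kappa>)"
    by (simp add: collapse)
  also have "\<dots> \<le> haar_weight d M *
      (\<Sum>\<alpha>\<in>G. real M * (\<Sum>p\<in>{1..2 ^ n}. cmod (grad (2 ^ n) x (\<alpha>(i := p)) i)))"
    by (intro mult_left_mono sum_mono line w)
  also have "\<dots> = haar_weight d M * real M * (\<Sum>\<alpha>\<in>grid d (2 ^ n). cmod (grad (2 ^ n) x \<alpha> i))"
    by (simp only: sum_distrib_left[symmetric] grid_split mult.assoc)
  also have "\<dots> \<le> haar_weight d M * real M * TV1 d (2 ^ n) x"
    unfolding TV1_def using w i by (intro mult_left_mono sum_mono member_le_sum) auto
  finally show ?thesis .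
qed

lemma TV1_nonneg: "0 \<le> TV1 d N x"
  unfolding TV1_def by (intro sum_nonneg) auto

text \<open>For \<open>d \<ge> 2\<close> the exponent is at most -1 while the base is at least 1.
  The bound is uniform in the scale, so summing over scales costs only a factor
  \<open>n\<close>.\<close>

lemma haar_weight_le:
  assumes "d \<ge> 2" "M > 0"
  shows "haar_weight d M * real M \<le> 1"
proof -
  have "haar_weight d M \<le> (2 * real M) powr (- 1)"
    unfolding haar_weight_def using assms by (intro powr_mono) auto
  then have "haar_weight d M * real M \<le> (2 * real M) powr (- 1) * real M"
    by (intro mult_right_mono) auto
  also have "\<dots> \<le> 1" using assms by (simp add: powr_minus)
  finally show ?thesis .
qed

lemma card_haar_types: "card (haar_types d) \<le> 2 ^ d"
proof -
  have "card (haar_types d) \<le> card ({..<d} \<rightarrow>\<^sub>E {0, 1::nat})"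
    by (intro card_mono finite_PiE) (auto simp: haar_types_def)
  also have "\<dots> = 2 ^ d" by (simp add: card_PiE numeral_2_eq_2)
  finally show ?thesis .
qed

lemma haar_coefficients_l1:
  assumes "d \<ge> 2"
  shows "(\<Sum>b\<in>haar_labels d n - {None}. cmod (haar_transform d n x b)) \<le>
    real n * 2 ^ d * TV1 d (2 ^ n) x"
proof -
  \<comment> \<open>Shifts and types are exchanged so that the type is fixed while the shifts
    vary.\<close>
  have "(\<Sum>b\<in>haar_labels d n - {None}. cmod (haar_transform d n x b)) =
      (\<Sum>j<n. \<Sum>e\<in>haar_types d. \<Sum>k\<in>{..<d} \<rightarrow>\<^sub>E {..<2 ^ j}.
        cmod (haar_transform d n x (Some (j, k, e))))"
    unfolding sum_haar_wavelets by (intro sum.cong refl sum.swap)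
  also have "\<dots> \<le> (\<Sum>j<n. \<Sum>e\<in>haar_types d. 1 * TV1 d (2 ^ n) x)"
    by (intro sum_mono order_trans[OF haar_coefficients_scale_type] mult_right_mono
        haar_weight_le assms TV1_nonneg) auto
  also have "\<dots> = real n * (real (card (haar_types d)) * TV1 d (2 ^ n) x)" by simp
  also have "\<dots> \<le> real n * (2 ^ d * TV1 d (2 ^ n) x)"
  proof (intro mult_left_mono mult_right_mono TV1_nonneg)
    have "real (card (haar_types d)) \<le> real (2 ^ d)" using card_haar_types of_nat_mono by blast
    then show "real (card (haar_types d)) \<le> 2 ^ d" by simp
  qed auto
  finally show ?thesis by (simp add: mult.assoc)
qed

text \<open>Cauchy-Schwarz against the constant 1 over the \<open>d\<close> directions, at each grid
  point.\<close>

lemma TV1_le_TV2: "TV1 d N x \<le> sqrt d * TV2 d N x"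
proof -
  have "(\<Sum>l<d. cmod (grad N x \<alpha> l)) \<le> sqrt d * sqrt (\<Sum>l<d. (cmod (grad N x \<alpha> l))\<^sup>2)" for \<alpha>
    using L2_set_mult_ineq[of "\<lambda>_. 1" "\<lambda>l. cmod (grad N x \<alpha> l)" "{..<d}"]
    by (simp add: L2_set_def)
  then show ?thesis
    unfolding TV1_def TV2_def sum_distrib_left by (intro sum_mono)
qed

section \<open>From Haar coefficients to the tube constraint\<close>

lemma linear_operator_haar_adjoint:
  assumes "linear_operator (grid d (2 ^ n)) J A"
  shows "linear_operator (haar_labels d n) J (A \<circ> haar_adjoint d n)"
proof -
  have mem: "haar_adjoint d n z \<in> arrays (grid d (2 ^ n))" for z
    by (simp add: haar_adjoint_def arrays_def)
  have add: "haar_adjoint d n (\<lambda>b. y b + z b) = (\<lambda>\<alpha>. haar_adjoint d n y \<alpha> + haar_adjoint d n z \<alpha>)"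
    for y z
    by (auto simp: haar_adjoint_def fun_eq_iff sum.distrib distrib_right)
  have scale: "haar_adjoint d n (\<lambda>b. c * z b) = (\<lambda>\<alpha>. c * haar_adjoint d n z \<alpha>)" for c z
    by (auto simp: haar_adjoint_def fun_eq_iff sum_distrib_left mult.assoc)
  show ?thesis
    using assms mem unfolding linear_operator_def o_def add scale by blast
qed

text \<open>Apply \<open>RIP_l2norm_bound\<close> to the Haar coefficients of \<open>v\<close> with
  \<open>None\<close> as the exempt index. Inversion identifies the measurements with
  \<open>A v\<close>, and Parseval identifies the norms.\<close>

lemma tube_bound:
  assumes d: "d \<ge> 2" and s: "s > 0"
    and A: "linear_operator (grid d (2 ^ n)) J A"
    and rip: "RIP (haar_labels d n) J (A \<circ> haar_adjoint d n) (2 * s) \<delta>"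
    and v: "v \<in> arrays (grid d (2 ^ n))"
  shows "sqrt (1 - \<delta>) * l2norm (grid d (2 ^ n)) v \<le>
    (1 + sqrt 2) * 2 ^ d / (real d * ln 2) * (TV1 d (2 ^ n) v / sqrt s) * ln (real ((2 ^ n) ^ d)) +
    l2norm J (A v)"
proof -
  define z where "z = haar_transform d n v"
  have "z \<in> arrays (haar_labels d n)"
    by (simp add: z_def haar_transform_def arrays_def)
  moreover have "None \<in> haar_labels d n" by (simp add: haar_labels_def)
  ultimately have "sqrt (1 - \<delta>) * l2norm (haar_labels d n) z \<le> l2norm J ((A \<circ> haar_adjoint d n) z) +
      (1 + sqrt 2) * (\<Sum>b\<in>haar_labels d n - {None}. cmod (z b)) / sqrt s"
    by (intro RIP_l2norm_bound finite_haar_labels s linear_operator_haar_adjoint A rip)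
  also have "\<dots> \<le> l2norm J ((A \<circ> haar_adjoint d n) z) +
      (1 + sqrt 2) * (real n * 2 ^ d * TV1 d (2 ^ n) v) / sqrt s"
    unfolding z_def using haar_coefficients_l1[OF d, of n v]
    by (intro add_left_mono divide_right_mono mult_left_mono) auto
  \<comment> \<open>The number of scales becomes the logarithm through
    \<open>ln (N ^ d) = d * ln 2 * n\<close>.\<close>
  also have "(1 + sqrt 2) * (real n * 2 ^ d * TV1 d (2 ^ n) v) / sqrt s =
      (1 + sqrt 2) * 2 ^ d / (real d * ln 2) * (TV1 d (2 ^ n) v / sqrt s) * ln (real ((2 ^ n) ^ d))"
  proof -
    have "ln (real ((2 ^ n) ^ d)) = real d * ln 2 * real n"
      by (simp add: ln_realpow flip: power_mult)
    then show ?thesis using d by simp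
  qed
  finally show ?thesis
    unfolding z_def o_def haar_adjoint_transform[OF v] l2norm_haar_transform[OF v] by linarith
qed

theorem theorem6:
  fixes d :: nat
  assumes "d \<ge> 2"
  shows "\<exists>C::real. C > 0 \<and>
    (\<forall>(n::nat) (N::nat) (s::nat) (m::nat) (\<delta>::real)
       (A :: ((nat \<Rightarrow> nat) \<Rightarrow> complex) \<Rightarrow> (nat \<Rightarrow> complex)).
      N = 2 ^ n \<and> s > 0 \<and> m > 0 \<and>
      linear_operator (grid d N) {..<m} A \<and>
      RIP (haar_labels d n) {..<m} (A \<circ> haar_adjoint d n) (2 * s) \<delta> \<longrightarrow>
      (\<forall>v \<in> arrays (grid d N). \<forall>\<epsilon>::real. l2norm {..<m} (A v) \<le> \<epsilon> \<longrightarrow>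
        l2norm (grid d N) v \<le>
          (C * (TV1 d N v / sqrt (real s)) * ln (real (N ^ d)) + \<epsilon>) / sqrt (1 - \<delta>) \<and>
        l2norm (grid d N) v \<le>
          (C * (TV2 d N v / sqrt (real s / real d)) * ln (real (N ^ d)) + \<epsilon>) / sqrt (1 - \<delta>)))"
proof -
  \<comment> \<open>\<open>2 ^ d\<close> bounds the number of types and \<open>d * ln 2\<close>
    converts the number of scales into the logarithm. \<open>C\<close> depends on \<open>d\<close>
    alone.\<close>
  define C where "C = (1 + sqrt 2) * 2 ^ d / (real d * ln 2)"
  have C: "C > 0"
    unfolding C_def using assms by (intro divide_pos_pos mult_pos_pos add_pos_pos) auto
  show ?thesis
  proof (rule exI[of _ C], intro conjI C allI impI ballI; elim conjE)
    fix n N s m :: nat and \<delta> \<epsilon> :: real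
      and A :: "((nat \<Rightarrow> nat) \<Rightarrow> complex) \<Rightarrow> nat \<Rightarrow> complex" and v
    assume N: "N = 2 ^ n" and s: "s > 0" and A: "linear_operator (grid d N) {..<m} A"
      and rip: "RIP (haar_labels d n) {..<m} (A \<circ> haar_adjoint d n) (2 * s) \<delta>"
      and v: "v \<in> arrays (grid d N)" and \<epsilon>: "l2norm {..<m} (A v) \<le> \<epsilon>"
    have \<delta>: "\<delta> < 1" using rip by (simp add: RIP_def)
    have TV1: "sqrt (1 - \<delta>) * l2norm (grid d N) v \<le>
        C * (TV1 d N v / sqrt s) * ln (real (N ^ d)) + \<epsilon>"
      using tube_bound[OF assms s A[unfolded N] rip v[unfolded N]] \<epsilon> unfolding N C_def by linarith
    then show "l2norm (grid d N) v \<le>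
        (C * (TV1 d N v / sqrt (real s)) * ln (real (N ^ d)) + \<epsilon>) / sqrt (1 - \<delta>)"
      using \<delta> by (simp add: pos_le_divide_eq mult.commute)
    \<comment> \<open>The factor \<open>sqrt d\<close> from comparing the seminorms is absorbed by
      replacing \<open>s\<close> with \<open>s / d\<close>, so the same \<open>C\<close> serves both
      estimates.\<close>
    have "TV1 d N v / sqrt s \<le> sqrt d * TV2 d N v / sqrt s"
      by (intro divide_right_mono TV1_le_TV2) auto
    also have "\<dots> = TV2 d N v / sqrt (real s / real d)"
      by (simp add: real_sqrt_divide)
    finally have "C * (TV1 d N v / sqrt s) * ln (real (N ^ d)) \<le>
        C * (TV2 d N v / sqrt (real s / real d)) * ln (real (N ^ d))"
      using C by (intro mult_right_mono mult_left_mono) (auto simp: N)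
    with TV1 show "l2norm (grid d N) v \<le>
        (C * (TV2 d N v / sqrt (real s / real d)) * ln (real (N ^ d)) + \<epsilon>) / sqrt (1 - \<delta>)"
      using \<delta> by (simp add: pos_le_divide_eq mult.commute)
  qed
qed

end
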